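(* Let $\xi\in H^{-s}$ and let $u^*\in H^t_g$ be the unique element of $H^t_g$ with $\mathcal{P}(u^* )=\xi$. Assume: (i) $\mathcal{P}:H^t_g\to H^{-s}$ is continuous; (ii) (local stability) there exist $\delta>0$ and a constant $C(\delta)>0$ such that for every $u\in H^t_g$ with $\|\mathcal{P}(u)-\xi\|_{H^{-s}}<\delta$ one has $\|u-u^*\|_{H^t}\le C(\delta)\|\mathcal{P}(u)-\xi\|_{H^{-s}}$; (iii) the embeddings $\mathcal{H}_K\hookrightarrow C(\overline\Omega)$ and $\mathcal{H}_K\hookrightarrow H^t$ are compact; (iv) $\mathcal{H}_K$ contains a dense subset of $H^t_g$ (i.e. $\mathcal{H}_K\cap H^t_g$ is dense in $H^t_g$ for the $H^t$ norm). For every sequence $(\gamma_n)_{n\in\mathbb{N}}$ of positive reals decreasing to $0$, let $u_n$ denote a minimizer of $$\inf\big\{\|\mathcal{P}(u)-\xi\|^2_{H^{-s}}+\gamma_n\|u\|^2_{\mathcal{H}_K}\;:\;u\in\mathcal{H}_K,\ u=g\text{ on }\partial\Omega\big\}.$$ Then the sequence $(u_n)_{n\in\mathbb{N}}\subset\mathcal{H}_K$ converges to $u^*$ in $H^t$, and $$\|\mathcal{P}(u_n)-\xi\|^2_{H^{-s}}+\gamma_n\|u_n\|^2_{\mathcal{H}_K}\to0\quad\text{as }n\to\infty.$$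
   Context: $\Omega\subset\mathbb{R}^d$ is a bounded open domain with Lipschitz boundary; all function spaces are over $\Omega$. $s>0$ and $t>\frac12$, with moreover $t>\frac d2$ so that the boundary condition can be interpreted pointwise. $H^t$ is the Sobolev space; $H^s_0$ is the closure in $H^s$ of the smooth compactly supported functions; $H^{-s}$ is the dual of $H^s_0$ with respect to the $L^2$ duality. For fixed continuous boundary data $g\in H^{t-1/2}(\partial\Omega)$, $H^t_g$ is the set of $u\in H^t$ whose trace on $\partial\Omega$ is $g$. $\mathcal{P}$ is a possibly nonlinear differential operator. $K:\overline\Omega\times\overline\Omega\to\mathbb{R}$ is a kernel with reproducing kernel Hilbert space (RKHS) $\mathcal{H}_K$; it is not assumed that $u^*\in\mathcal{H}_K$. *)

theory Defs
  imports "HOL-Analysis.Analysis"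
begin

text \<open>
  Near each boundary point, in suitable rotated coordinates with last axis \<open>e\<close>, the set is the
  part of a ball above the graph of a Lipschitz function on the hyperplane orthogonal to \<open>e\<close>.
\<close>
definition lipschitz_boundary :: "'a::euclidean_space set \<Rightarrow> bool" where
  "lipschitz_boundary \<Omega> \<longleftrightarrow>
     (\<forall>p\<in>frontier \<Omega>. \<exists>e r L h. norm e = 1 \<and> 0 < r \<and> L-lipschitz_on {y. y \<bullet> e = 0} h \<and>
        \<Omega> \<inter> ball p r = {x \<in> ball p r. h (x - (x \<bullet> e) *\<^sub>R e) < x \<bullet> e})"

text \<open>
  A partial derivative of order \<open>k\<close> is indexed by a list of \<open>k\<close> coordinate directions, so that
  sums over all lists of length \<open>k\<close> give the Euclidean norm of the full tensor of \<open>k\<close>-th order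
  derivatives.
\<close>
definition multi_indices :: "nat \<Rightarrow> 'a::euclidean_space list set" where
  "multi_indices k = {bs. set bs \<subseteq> Basis \<and> length bs = k}"

fun partial_deriv :: "'a::euclidean_space list \<Rightarrow> ('a \<Rightarrow> real) \<Rightarrow> 'a \<Rightarrow> real" where
  "partial_deriv [] f = f"
| "partial_deriv (b # bs) f = (\<lambda>x. frechet_derivative (partial_deriv bs f) (at x) b)"

definition smooth :: "('a::euclidean_space \<Rightarrow> real) \<Rightarrow> bool" where
  "smooth f \<longleftrightarrow> (\<forall>k. \<forall>bs\<in>multi_indices k. \<forall>x. partial_deriv bs f differentiable (at x))"

definition test_functions :: "'a::euclidean_space set \<Rightarrow> ('a \<Rightarrow> real) set" where
  "test_functions \<Omega> = {\<phi>. smooth \<phi> \<and> compact (closure {x. \<phi> x \<noteq> 0}) \<and> closure {x. \<phi> x \<noteq> 0} \<subseteq> \<Omega>}"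

text \<open>
  Elements of \<open>L\<^sup>2(\<Omega>)\<close> and of the Sobolev spaces are represented by functions on the whole space;
  only their values on \<open>\<Omega>\<close>, up to null sets, matter. The norms are thus seminorms on functions,
  vanishing exactly on the functions that are zero almost everywhere in \<open>\<Omega>\<close>.
\<close>
definition L2_on :: "'a::euclidean_space set \<Rightarrow> ('a \<Rightarrow> real) set" where
  "L2_on \<Omega> = {f. f \<in> borel_measurable (lebesgue_on \<Omega>) \<and> integrable (lebesgue_on \<Omega>) (\<lambda>x. (f x)\<^sup>2)}"

definition has_weak_deriv ::
    "'a::euclidean_space set \<Rightarrow> 'a list \<Rightarrow> ('a \<Rightarrow> real) \<Rightarrow> ('a \<Rightarrow> real) \<Rightarrow> bool" where
  "has_weak_deriv \<Omega> bs u w \<longleftrightarrow>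
     (\<forall>\<phi>\<in>test_functions \<Omega>.
        (\<integral>x. u x * partial_deriv bs \<phi> x \<partial>lebesgue_on \<Omega>) =
        (- 1) ^ length bs * (\<integral>x. w x * \<phi> x \<partial>lebesgue_on \<Omega>))"

text \<open>If it exists, the weak derivative is unique up to null sets.\<close>
definition weak_deriv :: "'a::euclidean_space set \<Rightarrow> 'a list \<Rightarrow> ('a \<Rightarrow> real) \<Rightarrow> 'a \<Rightarrow> real" where
  "weak_deriv \<Omega> bs u = (SOME w. w \<in> L2_on \<Omega> \<and> has_weak_deriv \<Omega> bs u w)"

text \<open>
  Sobolev--Slobodeckij spaces of real order \<open>t \<ge> 0\<close>: weak derivatives up to order \<open>\<lfloor>t\<rfloor>\<close> in
  \<open>L\<^sup>2\<close>, and for non-integer \<open>t\<close> a finite Gagliardo seminorm of exponent \<open>t - \<lfloor>t\<rfloor>\<close> for the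
  derivatives of order \<open>\<lfloor>t\<rfloor>\<close>.
\<close>
definition gagliardo :: "'a::euclidean_space set \<Rightarrow> real \<Rightarrow> ('a \<Rightarrow> real) \<Rightarrow> ennreal" where
  "gagliardo \<Omega> \<theta> w =
     (\<integral>\<^sup>+(x, y). ennreal ((w x - w y)\<^sup>2 / norm (x - y) powr (real DIM('a) + 2 * \<theta>))
        \<partial>(lebesgue_on \<Omega> \<Otimes>\<^sub>M lebesgue_on \<Omega>))"

definition sobolev :: "'a::euclidean_space set \<Rightarrow> real \<Rightarrow> ('a \<Rightarrow> real) set" where
  "sobolev \<Omega> t =
     {u \<in> L2_on \<Omega>.
        (\<forall>k \<le> nat \<lfloor>t\<rfloor>. \<forall>bs\<in>multi_indices k. \<exists>w\<in>L2_on \<Omega>. has_weak_deriv \<Omega> bs u w) \<and>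
        (t \<notin> \<int> \<longrightarrow> (\<forall>bs\<in>multi_indices (nat \<lfloor>t\<rfloor>). gagliardo \<Omega> (frac t) (weak_deriv \<Omega> bs u) < \<infinity>))}"

definition sobolev_norm :: "'a::euclidean_space set \<Rightarrow> real \<Rightarrow> ('a \<Rightarrow> real) \<Rightarrow> real" where
  "sobolev_norm \<Omega> t u =
     sqrt ((\<Sum>k \<le> nat \<lfloor>t\<rfloor>. \<Sum>bs\<in>multi_indices k. \<integral>x. (weak_deriv \<Omega> bs u x)\<^sup>2 \<partial>lebesgue_on \<Omega>) +
           (if t \<in> \<int> then 0
            else \<Sum>bs\<in>multi_indices (nat \<lfloor>t\<rfloor>). enn2real (gagliardo \<Omega> (frac t) (weak_deriv \<Omega> bs u))))"

definition sobolev0 :: "'a::euclidean_space set \<Rightarrow> real \<Rightarrow> ('a \<Rightarrow> real) set" where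
  "sobolev0 \<Omega> s =
     {u \<in> sobolev \<Omega> s. \<forall>\<epsilon>>0. \<exists>\<phi>\<in>test_functions \<Omega>. sobolev_norm \<Omega> s (u - \<phi>) < \<epsilon>}"

text \<open>
  \<open>H\<^sup>-\<^sup>s\<close> consists of the bounded linear functionals on \<open>H\<^sup>s\<^sub>0\<close>, extended by zero to all functions so
  that two functionals are equal in \<open>H\<^sup>-\<^sup>s\<close> iff they are equal as HOL functions. (A function
  \<open>f \<in> L\<^sup>2\<close> corresponds to the functional \<open>\<phi> \<mapsto> \<integral> f \<phi>\<close>.)
\<close>
definition sobolev_dual :: "'a::euclidean_space set \<Rightarrow> real \<Rightarrow> (('a \<Rightarrow> real) \<Rightarrow> real) set" where
  "sobolev_dual \<Omega> s =
     {F. (\<forall>\<phi>\<in>sobolev0 \<Omega> s. \<forall>\<psi>\<in>sobolev0 \<Omega> s. F (\<lambda>x. \<phi> x + \<psi> x) = F \<phi> + F \<psi>) \<and>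
         (\<forall>c. \<forall>\<phi>\<in>sobolev0 \<Omega> s. F (\<lambda>x. c * \<phi> x) = c * F \<phi>) \<and>
         (\<exists>B. \<forall>\<phi>\<in>sobolev0 \<Omega> s. \<bar>F \<phi>\<bar> \<le> B * sobolev_norm \<Omega> s \<phi>) \<and>
         (\<forall>\<phi>. \<phi> \<notin> sobolev0 \<Omega> s \<longrightarrow> F \<phi> = 0)}"

definition sobolev_dual_norm ::
    "'a::euclidean_space set \<Rightarrow> real \<Rightarrow> (('a \<Rightarrow> real) \<Rightarrow> real) \<Rightarrow> real" where
  "sobolev_dual_norm \<Omega> s F = (SUP \<phi>\<in>{\<phi> \<in> sobolev0 \<Omega> s. sobolev_norm \<Omega> s \<phi> \<le> 1}. \<bar>F \<phi>\<bar>)"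

text \<open>
  For \<open>t > d/2\<close> and bounded Lipschitz \<open>\<Omega>\<close>, every \<open>u \<in> H\<^sup>t(\<Omega>)\<close> has a unique representative that is continuous up to the
  boundary, and its trace is the restriction of that representative to \<open>\<partial>\<Omega>\<close>.
\<close>
definition has_trace :: "'a::euclidean_space set \<Rightarrow> ('a \<Rightarrow> real) \<Rightarrow> ('a \<Rightarrow> real) \<Rightarrow> bool" where
  "has_trace \<Omega> u g \<longleftrightarrow>
     (\<exists>v. continuous_on (closure \<Omega>) v \<and> (AE x in lebesgue_on \<Omega>. u x = v x) \<and>
          (\<forall>x\<in>frontier \<Omega>. v x = g x))"

text \<open>
  \<open>H\<^sup>\<sigma>(\<partial>\<Omega>)\<close> as the trace space of \<open>H\<^bsup>\<sigma>+1/2\<^esup>(\<Omega>)\<close>, for \<open>\<sigma> + 1/2 > d/2\<close>. An intrinsic definition through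
  Lipschitz charts would be available for \<open>\<sigma> \<le> 1\<close> only.
\<close>
definition boundary_sobolev :: "'a::euclidean_space set \<Rightarrow> real \<Rightarrow> ('a \<Rightarrow> real) set" where
  "boundary_sobolev \<Omega> \<sigma> = {g. \<exists>u\<in>sobolev \<Omega> (\<sigma> + 1/2). has_trace \<Omega> u g}"

definition sobolev_bc :: "'a::euclidean_space set \<Rightarrow> real \<Rightarrow> ('a \<Rightarrow> real) \<Rightarrow> ('a \<Rightarrow> real) set" where
  "sobolev_bc \<Omega> t g = {u \<in> sobolev \<Omega> t. has_trace \<Omega> u g}"

text \<open>
  Functions on \<open>X\<close> are represented by functions vanishing outside \<open>X\<close>.
\<close>
definition hilbert_function_space ::
    "'a set \<Rightarrow> ('a \<Rightarrow> real) set \<Rightarrow> (('a \<Rightarrow> real) \<Rightarrow> ('a \<Rightarrow> real) \<Rightarrow> real) \<Rightarrow> bool" where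
  "hilbert_function_space X H ip \<longleftrightarrow>
     (\<forall>f\<in>H. \<forall>x. x \<notin> X \<longrightarrow> f x = 0) \<and>
     (\<lambda>x. 0) \<in> H \<and>
     (\<forall>f\<in>H. \<forall>g\<in>H. (\<lambda>x. f x + g x) \<in> H) \<and>
     (\<forall>c. \<forall>f\<in>H. (\<lambda>x. c * f x) \<in> H) \<and>
     (\<forall>f\<in>H. \<forall>g\<in>H. ip f g = ip g f) \<and>
     (\<forall>f\<in>H. \<forall>g\<in>H. \<forall>h\<in>H. ip (\<lambda>x. f x + g x) h = ip f h + ip g h) \<and>
     (\<forall>c. \<forall>f\<in>H. \<forall>g\<in>H. ip (\<lambda>x. c * f x) g = c * ip f g) \<and>
     (\<forall>f\<in>H. 0 \<le> ip f f) \<and>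
     (\<forall>f\<in>H. ip f f = 0 \<longrightarrow> f = (\<lambda>x. 0)) \<and>
     (\<forall>f::nat \<Rightarrow> 'a \<Rightarrow> real. (\<forall>n. f n \<in> H) \<longrightarrow>
        (\<forall>\<epsilon>>0. \<exists>N. \<forall>m\<ge>N. \<forall>n\<ge>N. sqrt (ip (f m - f n) (f m - f n)) < \<epsilon>) \<longrightarrow>
        (\<exists>l\<in>H. (\<lambda>n. sqrt (ip (f n - l) (f n - l))) \<longlonglongrightarrow> 0))"

text \<open>
  \<open>(H, ip)\<close> is the reproducing kernel Hilbert space of the kernel \<open>K\<close> on \<open>X\<close>. By the Moore--Aronszajn
  theorem it is uniquely determined by \<open>K\<close>, and it exists iff \<open>K\<close> is symmetric and positive
  semidefinite on \<open>X\<close>.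
\<close>
definition is_rkhs ::
    "'a set \<Rightarrow> ('a \<Rightarrow> 'a \<Rightarrow> real) \<Rightarrow> ('a \<Rightarrow> real) set \<Rightarrow> (('a \<Rightarrow> real) \<Rightarrow> ('a \<Rightarrow> real) \<Rightarrow> real) \<Rightarrow> bool" where
  "is_rkhs X K H ip \<longleftrightarrow>
     hilbert_function_space X H ip \<and>
     (\<forall>x\<in>X. (\<lambda>y. if y \<in> X then K x y else 0) \<in> H) \<and>
     (\<forall>x\<in>X. \<forall>f\<in>H. ip f (\<lambda>y. if y \<in> X then K x y else 0) = f x)"

definition ip_norm :: "(('a \<Rightarrow> real) \<Rightarrow> ('a \<Rightarrow> real) \<Rightarrow> real) \<Rightarrow> ('a \<Rightarrow> real) \<Rightarrow> real" where
  "ip_norm ip f = sqrt (ip f f)"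

definition sup_norm :: "'a set \<Rightarrow> ('a \<Rightarrow> real) \<Rightarrow> real" where
  "sup_norm X f = (SUP x\<in>X. \<bar>f x\<bar>)"

definition compactly_embedded ::
    "('a \<Rightarrow> real) set \<Rightarrow> (('a \<Rightarrow> real) \<Rightarrow> real) \<Rightarrow> ('a \<Rightarrow> real) set \<Rightarrow> (('a \<Rightarrow> real) \<Rightarrow> real) \<Rightarrow> bool" where
  "compactly_embedded V normV W normW \<longleftrightarrow>
     V \<subseteq> W \<and>
     (\<exists>C. \<forall>f\<in>V. normW f \<le> C * normV f) \<and>
     (\<forall>f::nat \<Rightarrow> 'a \<Rightarrow> real. (\<forall>n. f n \<in> V) \<longrightarrow> (\<exists>B. \<forall>n. normV (f n) \<le> B) \<longrightarrow>
        (\<exists>l\<in>W. \<exists>r. strict_mono (r::nat \<Rightarrow> nat) \<and> (\<lambda>n. normW (f (r n) - l)) \<longlonglongrightarrow> 0))"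

end

theory Submission
  imports Defs
begin

text \<open>
  By density and continuity of \<open>P\<close> at \<open>ustar\<close>, some \<open>w\<close> in the RKHS with the right boundary
  values has arbitrarily small residual. Minimality bounds the objective at \<open>u n\<close> by the one at
  \<open>w\<close>, whose regularization term vanishes in the limit, so the optimal values, and with them the
  residuals of \<open>u n\<close>, tend to \<open>0\<close>; local stability turns this into convergence in \<open>H\<^sup>t\<close>.

  What needs work is that the dual norm is nonnegative, that is, that the zero function lies in
  \<open>H\<^sup>s\<^sub>0\<close>: this uses the uniqueness of weak derivatives, proved with smooth approximations of
  the indicator functions of boxes.
\<close>

section \<open>Flat exponentials and a derivative-closed algebra of smooth functions\<close>

text \<open>For \<open>k = 0\<close> this is the classical smooth function that vanishes to infinite
  order at 0. The factor \<open>inverse x ^ k\<close> closes the span of the family under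
  differentiation.\<close>

definition flat_exp :: "nat \<Rightarrow> real \<Rightarrow> real" where
  "flat_exp k x = (if x \<le> 0 then 0 else exp (- inverse x) * inverse x ^ k)"

text \<open>From the right, \<open>y = inverse x\<close> reduces the claim to
  \<open>y ^ k / exp y\<close> tending to 0 at infinity; from the left the function is 0.\<close>

lemma flat_exp_tendsto_0: "(flat_exp k \<longlongrightarrow> 0) (at 0)"
proof -
  have "((\<lambda>x. inverse x ^ k / exp (inverse x)) \<longlongrightarrow> 0) (at_right (0::real))"
    by (rule filterlim_compose[OF tendsto_power_div_exp_0 filterlim_inverse_at_top_right])
  moreover have "\<forall>\<^sub>F x in at_right 0. inverse x ^ k / exp (inverse x) = flat_exp k x"
    by (auto simp: eventually_at_filter flat_exp_def exp_minus divide_inverse)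
  ultimately have "(flat_exp k \<longlongrightarrow> 0) (at_right 0)"
    by (rule Lim_transform_eventually)
  moreover have "(flat_exp k \<longlongrightarrow> 0) (at_left 0)"
    by (rule Lim_transform_eventually[OF tendsto_const])
       (auto simp: eventually_at_filter flat_exp_def)
  ultimately show ?thesis
    by (simp add: filterlim_split_at)
qed

text \<open>At 0 the difference quotient of \<open>flat_exp k\<close> is
  \<open>flat_exp (Suc k)\<close>, whose limit is already known; elsewhere the product and chain
  rules apply.\<close>

lemma flat_exp_has_derivative:
  "(flat_exp k has_real_derivative flat_exp (k + 2) x - real k * flat_exp (k + 1) x) (at x)"
proof -
  consider "x < 0" | "x = 0" | "x > 0" by linarith
  then show ?thesis
  proof cases
    case 1
    have "((\<lambda>x. 0) has_real_derivative flat_exp (k + 2) x - real k * flat_exp (k + 1) x) (at x)"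
      using 1 by (auto simp: flat_exp_def)
    then show ?thesis
      by (rule has_field_derivative_transform_within_open[where S="{..<0}"])
         (use 1 in \<open>auto simp: flat_exp_def\<close>)
  next
    case 2
    have "\<forall>\<^sub>F h in at 0. flat_exp (Suc k) h = (flat_exp k (0 + h) - flat_exp k 0) / h"
      by (auto simp: eventually_at_filter flat_exp_def divide_inverse)
    then show ?thesis
      using Lim_transform_eventually[OF flat_exp_tendsto_0[of "Suc k"]] 2
      by (auto simp: DERIV_def flat_exp_def)
  next
    case 3
    have "((\<lambda>x. exp (- inverse x) * inverse x ^ k) has_real_derivative
        flat_exp (k + 2) x - real k * flat_exp (k + 1) x) (at x)"
      using 3
      \<comment> \<open>The power rule leaves the truncated exponent \<open>k - 1\<close>, so
        \<open>k = 0\<close> is split off.\<close>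
      by (auto intro!: derivative_eq_intros simp: flat_exp_def power2_eq_square)
         (cases k; simp add: algebra_simps)
    then show ?thesis
      by (rule has_field_derivative_transform_within_open[where S="{0<..}"])
         (use 3 in \<open>auto simp: flat_exp_def\<close>)
  qed
qed

text \<open>A class of smooth functions that is visibly closed under partial derivatives.\<close>
inductive_set flat_algebra :: "('a::euclidean_space \<Rightarrow> real) set" where
  const: "(\<lambda>x. c) \<in> flat_algebra"
| ridge: "(\<lambda>x. flat_exp k (x \<bullet> v + c)) \<in> flat_algebra"
| add: "f \<in> flat_algebra \<Longrightarrow> g \<in> flat_algebra \<Longrightarrow> (\<lambda>x. f x + g x) \<in> flat_algebra"
| mult: "f \<in> flat_algebra \<Longrightarrow> g \<in> flat_algebra \<Longrightarrow> (\<lambda>x. f x * g x) \<in> flat_algebra"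

lemma flat_algebra_has_derivative:
  fixes f :: "'a::euclidean_space \<Rightarrow> real"
  assumes "f \<in> flat_algebra"
  obtains D where "\<And>x. (f has_derivative D x) (at x)" "\<And>b. (\<lambda>x. D x b) \<in> flat_algebra"
proof -
  from assms have "\<exists>D. (\<forall>x. (f has_derivative D x) (at x)) \<and> (\<forall>b. (\<lambda>x. D x b) \<in> flat_algebra)"
  proof induction
    case (const c)
    show ?case
      by (rule exI[of _ "\<lambda>x b. 0"]) (auto intro: flat_algebra.const)
  next
    case (ridge k v c)
    let ?D = "\<lambda>(x::'a) (b::'a).
      (b \<bullet> v) * (flat_exp (k + 2) (x \<bullet> v + c) + - real k * flat_exp (k + 1) (x \<bullet> v + c))"
    have "((\<lambda>x. flat_exp k (x \<bullet> v + c)) has_derivative ?D x) (at x)" for x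
    proof -
      have inner: "((\<lambda>x. x \<bullet> v + c) has_derivative (\<lambda>b. b \<bullet> v)) (at x)"
        by (auto intro!: derivative_eq_intros)
      have outer: "(flat_exp k has_derivative
          (*) (flat_exp (k + 2) (x \<bullet> v + c) - real k * flat_exp (k + 1) (x \<bullet> v + c)))
          (at (x \<bullet> v + c))"
        using flat_exp_has_derivative by (simp add: has_field_derivative_def)
      show ?thesis
        using has_derivative_compose[OF inner outer] by (simp add: mult.commute)
    qed
    moreover have "(\<lambda>x. ?D x b) \<in> flat_algebra" for b
      by (intro flat_algebra.intros)
    ultimately show ?case by (intro exI[of _ ?D] conjI allI)
  next
    case (add f g)
    then obtain Df Dg where
      "\<And>x. (f has_derivative Df x) (at x)" "\<And>b. (\<lambda>x. Df x b) \<in> flat_algebra"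
      "\<And>x. (g has_derivative Dg x) (at x)" "\<And>b. (\<lambda>x. Dg x b) \<in> flat_algebra"
      by blast
    then show ?case
      by (intro exI[of _ "\<lambda>x b. Df x b + Dg x b"])
         (auto intro: has_derivative_add flat_algebra.add)
  next
    case (mult f g)
    then obtain Df Dg where
      "\<And>x. (f has_derivative Df x) (at x)" "\<And>b. (\<lambda>x. Df x b) \<in> flat_algebra"
      "\<And>x. (g has_derivative Dg x) (at x)" "\<And>b. (\<lambda>x. Dg x b) \<in> flat_algebra"
      by blast
    with mult.hyps show ?case
      by (intro exI[of _ "\<lambda>x b. f x * Dg x b + Df x b * g x"])
         (auto intro!: has_derivative_mult flat_algebra.add flat_algebra.mult)
  qed
  with that show ?thesis by blast
qed

text \<open>By uniqueness, \<open>frechet_derivative\<close> returns the derivative already found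
  inside the class, so the induction can go on to any order.\<close>

lemma partial_deriv_flat_algebra:
  assumes "f \<in> flat_algebra"
  shows "partial_deriv bs f \<in> flat_algebra"
proof (induction bs)
  case (Cons b bs)
  obtain D where D: "\<And>x. (partial_deriv bs f has_derivative D x) (at x)"
      "\<And>b. (\<lambda>x. D x b) \<in> flat_algebra"
    using flat_algebra_has_derivative[OF Cons.IH] by metis
  have "frechet_derivative (partial_deriv bs f) (at x) = D x" for x
    using frechet_derivative_at[OF D(1)] by simp
  then show ?case using D(2) by simp
qed (use assms in simp)

lemma smooth_flat_algebra: "f \<in> flat_algebra \<Longrightarrow> smooth f"
  by (metis smooth_def partial_deriv_flat_algebra flat_algebra_has_derivative differentiable_def)

lemma flat_algebra_prod:
  assumes "\<And>i. i \<in> I \<Longrightarrow> f i \<in> flat_algebra"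
  shows "(\<lambda>x. \<Prod>i\<in>I. f i x) \<in> flat_algebra"
  using assms
  by (induction I rule: infinite_finite_induct) (auto intro: flat_algebra.intros)

section \<open>Test functions approximating indicators of boxes\<close>

text \<open>Each coordinate contributes one factor per face. Growing \<open>n\<close> steepens the
  factors towards 1 inside the box, and \<open>Suc n\<close> keeps the scale positive.\<close>

definition box_bump :: "'a::euclidean_space \<Rightarrow> 'a \<Rightarrow> nat \<Rightarrow> 'a \<Rightarrow> real" where
  "box_bump a b n x =
     (\<Prod>i\<in>Basis. flat_exp 0 (real (Suc n) * (x \<bullet> i - a \<bullet> i)) * flat_exp 0 (real (Suc n) * (b \<bullet> i - x \<bullet> i)))"

lemma box_bump_flat_algebra: "box_bump a b n \<in> flat_algebra"
proof -
  have *: "(\<lambda>x. flat_exp 0 (real (Suc n) * (x \<bullet> i - a \<bullet> i))) \<in> flat_algebra"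
          "(\<lambda>x. flat_exp 0 (real (Suc n) * (b \<bullet> i - x \<bullet> i))) \<in> flat_algebra" for i :: 'a
    \<comment> \<open>Scale and translation are absorbed into the direction and the offset of a
      ridge function.\<close>
    using flat_algebra.ridge[of 0 "real (Suc n) *\<^sub>R i" "- real (Suc n) * (a \<bullet> i)"]
      flat_algebra.ridge[of 0 "- real (Suc n) *\<^sub>R i" "real (Suc n) * (b \<bullet> i)"]
    by (simp_all only: inner_scaleR_right right_diff_distrib minus_mult_left[symmetric]
          add_uminus_conv_diff uminus_add_conv_diff)
  show ?thesis
    unfolding box_bump_def[abs_def] by (intro flat_algebra_prod flat_algebra.mult *)
qed

lemma box_bump_eq_0: "x \<notin> box a b \<Longrightarrow> box_bump a b n x = 0"
  by (force simp: box_bump_def box_def flat_exp_def not_less mult_le_0_iff)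

lemma abs_box_bump_le_1: "\<bar>box_bump a b n x\<bar> \<le> 1"
proof -
  have "0 \<le> flat_exp 0 y \<and> flat_exp 0 y \<le> 1" for y
    by (auto simp: flat_exp_def)
  then have "0 \<le> box_bump a b n x" "box_bump a b n x \<le> 1"
    unfolding box_bump_def by (auto intro!: prod_nonneg prod_le_1 mult_le_one)
  then show ?thesis by simp
qed

lemma box_bump_tendsto: "(\<lambda>n. box_bump a b n x) \<longlonglongrightarrow> indicator (box a b) x"
proof (cases "x \<in> box a b")
  case True
  \<comment> \<open>\<open>c\<close> is the positive distance of a coordinate from a face; the
    factor is \<open>exp (- 1 / ((n + 1) * c))\<close>.\<close>
  have *: "(\<lambda>n. flat_exp 0 (real (Suc n) * c)) \<longlonglongrightarrow> 1" if "c > 0" for c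
  proof -
    have "(\<lambda>n. exp (- (inverse (real (Suc n)) * inverse c))) \<longlonglongrightarrow> exp (- (0 * inverse c))"
      by (intro tendsto_intros LIMSEQ_inverse_real_of_nat)
    moreover have "flat_exp 0 (real (Suc n) * c) = exp (- (inverse (real (Suc n)) * inverse c))" for n
      using that by (simp add: flat_exp_def mult_le_0_iff not_le[symmetric])
    ultimately show ?thesis by simp
  qed
  have "(\<lambda>n. box_bump a b n x) \<longlonglongrightarrow> (\<Prod>i\<in>(Basis :: 'a set). 1 * 1)"
    unfolding box_bump_def
    by (intro tendsto_prod tendsto_mult *) (use True in \<open>auto simp: box_def\<close>)
  with True show ?thesis by simp
qed (simp add: box_bump_eq_0)

lemma box_bump_test_function:
  assumes "cbox a b \<subseteq> \<Omega>"
  shows "box_bump a b n \<in> test_functions \<Omega>"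
proof -
  have "{x. box_bump a b n x \<noteq> 0} \<subseteq> box a b"
    using box_bump_eq_0 by blast
  then have "closure {x. box_bump a b n x \<noteq> 0} \<subseteq> cbox a b"
    by (meson closure_minimal closed_cbox box_subset_cbox order_trans)
  moreover from this have "compact (closure {x. box_bump a b n x \<noteq> 0})"
    by (meson bounded_cbox bounded_subset closed_closure compact_eq_bounded_closed)
  ultimately show ?thesis
    using assms smooth_flat_algebra[OF box_bump_flat_algebra, of a b n] by (auto simp: test_functions_def)
qed

lemma borel_measurable_box_bump: "box_bump a b n \<in> borel_measurable borel"
proof (rule borel_measurable_continuous_onI)
  show "continuous_on UNIV (box_bump a b n)"
    by (metis box_bump_flat_algebra flat_algebra_has_derivative has_derivative_continuous_on
        has_derivative_at_withinI)
qed

section \<open>The fundamental lemma of the calculus of variations\<close>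

text \<open>Open boxes form an intersection-stable generator of the Borel sets, so a Dynkin-system
  argument gives zero integral over every Borel set; uniqueness of densities then compares
  \<open>f\<close> with 0.\<close>

lemma AE_zero_if_box_integrals_zero:
  fixes f :: "'a::euclidean_space \<Rightarrow> real"
  assumes f: "integrable lborel f"
    and boxes: "\<And>a b. (LINT x:box a b|lborel. f x) = 0"
  shows "AE x in lborel. f x = 0"
proof (rule density_unique_real[OF f])
  show "integrable lborel (\<lambda>x::'a. 0 :: real)" by simp
  fix A :: "'a set" assume "A \<in> sets lborel"
  then have A: "A \<in> sigma_sets UNIV (range (\<lambda>(a, b). box a b))"
    by (simp add: borel_eq_box)
  have si: "set_integrable lborel A f" if "A \<in> sets borel" for A
    using f that integrable_mult_indicator[of A lborel f] by (simp add: set_integrable_def)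
  have borel: "A \<in> sets borel" if "A \<in> sigma_sets UNIV (range (\<lambda>(a, b). box a b))" for A :: "'a set"
    using that by (simp add: borel_eq_box)
  let ?B = "\<lambda>n::nat. box (- (real n *\<^sub>R One)) (real n *\<^sub>R One) :: 'a set"
  \<comment> \<open>Boxes exhausting the space give total integral 0, which the complement step
    below needs.\<close>
  have "(\<lambda>n. LINT x:?B n|lborel. f x) \<longlonglongrightarrow> (LINT x:(\<Union>n. ?B n)|lborel. f x)"
  proof (rule set_integral_cont_up)
    show "incseq ?B"
      by (force simp: incseq_def box_def intro: less_le_trans le_less_trans)
  qed (auto intro: si)
  then have total: "(LINT x|lborel. f x) = 0"
    unfolding UN_box_eq_UNIV using boxes
    by (simp add: set_lebesgue_integral_def LIMSEQ_const_iff)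
  have "Int_stable (range (\<lambda>(a, b). box a b :: 'a set))"
    by (auto simp: Int_stable_def box_Int_box)
  moreover have "range (\<lambda>(a, b). box a b :: 'a set) \<subseteq> Pow UNIV" by simp
  ultimately have "(LINT x:A|lborel. f x) = 0"
    using A
  proof (induction rule: sigma_sets_induct_disjoint)
    case (compl A)
    then have "(LINT x:UNIV|lborel. f x) = (LINT x:A|lborel. f x) + (LINT x:UNIV - A|lborel. f x)"
      by (subst set_integral_Un[symmetric]) (auto intro!: si borel sigma_sets.Compl)
    with compl total show ?case by (simp add: set_lebesgue_integral_def)
  next
    case (union A)
    then have "(LINT x:(\<Union>i. A i)|lborel. f x) = (\<Sum>i. LINT x:A i|lborel. f x)"
      by (intro lebesgue_integral_countable_add si)
         (auto simp: disjoint_family_on_def intro!: borel sigma_sets.Union)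
    with union show ?case by simp
  qed (use boxes in \<open>auto simp: set_lebesgue_integral_def\<close>)
  then show "(LINT x:A|lborel. f x) = (LINT x:A|lborel. 0)"
    by (simp add: set_lebesgue_integral_def)
qed

lemma L2_on_imp_integrable:
  fixes w :: "'a::euclidean_space \<Rightarrow> real"
  assumes "w \<in> L2_on \<Omega>" "open \<Omega>" "bounded \<Omega>"
  shows "integrable (lebesgue_on \<Omega>) w"
proof (rule Bochner_Integration.integrable_bound)
  have "finite_measure (lebesgue_on \<Omega>)"
    using assms by (intro finite_measure_lebesgue_on) (simp add: bounded_set_imp_lmeasurable)
  then show "integrable (lebesgue_on \<Omega>) (\<lambda>x. 1 + (w x)\<^sup>2)"
    using assms by (auto simp: L2_on_def finite_measure.integrable_const)
  \<comment> \<open>Expanding \<open>(\<bar>y\<bar> - 1)^2 \<ge> 0\<close> gives this; the constant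
    1 is integrable because a bounded open set has finite measure.\<close>
  have "\<bar>y\<bar> \<le> 1 + y\<^sup>2" for y :: real
    using sum_power2_ge_zero[of "\<bar>y\<bar> - 1" 0] by (simp add: power2_diff)
  then show "AE x in lebesgue_on \<Omega>. norm (w x) \<le> norm (1 + (w x)\<^sup>2)"
    by simp
qed (use assms in \<open>simp add: L2_on_def\<close>)

text \<open>Bumps converge boundedly to box indicators, so \<open>w\<close> has zero integral over
  each box whose closed box lies in \<open>\<Omega>\<close>. This makes \<open>w\<close> vanish
  almost everywhere on each such box, and countably many of them cover
  \<open>\<Omega>\<close>.\<close>

lemma fundamental_lemma_variations:
  fixes w :: "'a::euclidean_space \<Rightarrow> real"
  assumes "open \<Omega>" and w: "integrable (lebesgue_on \<Omega>) w"
    and zero: "\<And>\<phi>. \<phi> \<in> test_functions \<Omega> \<Longrightarrow> (\<integral>x. w x * \<phi> x \<partial>lebesgue_on \<Omega>) = 0"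
  shows "AE x in lebesgue_on \<Omega>. w x = 0"
proof -
  have [measurable]: "\<Omega> \<in> sets lebesgue" using \<open>open \<Omega>\<close> by auto
  \<comment> \<open>Extension by zero moves all integrals to the whole space.\<close>
  define W where "W x = indicator \<Omega> x *\<^sub>R w x" for x
  have W: "integrable lebesgue W"
    using w unfolding W_def by (simp add: integrable_restrict_space)
  then have [measurable]: "W \<in> borel_measurable lebesgue" by auto
  have W_zero: "(LINT x:box a b|lebesgue. W x) = 0" if ab: "cbox a b \<subseteq> \<Omega>" for a b
  proof -
    \<comment> \<open>Dominated convergence with majorant \<open>\<bar>W x\<bar>\<close>, since
      bumps are bounded by 1.\<close>
    have "(\<lambda>n. \<integral>x. W x * box_bump a b n x \<partial>lebesgue) \<longlonglongrightarrow> (\<integral>x. W x * indicator (box a b) x \<partial>lebesgue)"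
    proof (rule integral_dominated_convergence[where w="\<lambda>x. \<bar>W x\<bar>"])
      show "AE x in lebesgue. (\<lambda>n. W x * box_bump a b n x) \<longlonglongrightarrow> W x * indicator (box a b) x"
        by (intro AE_I2 tendsto_intros box_bump_tendsto)
      show "AE x in lebesgue. norm (W x * box_bump a b n x) \<le> \<bar>W x\<bar>" for n
        by (simp add: abs_mult abs_box_bump_le_1 mult_left_le)
      have "box_bump a b n \<in> borel_measurable lebesgue" for n
        by (intro measurable_completion) (simp add: borel_measurable_box_bump)
      then show "(\<lambda>x. W x * box_bump a b n x) \<in> borel_measurable lebesgue" for n
        using borel_measurable_times[OF \<open>W \<in> borel_measurable lebesgue\<close>] by blast
      have "(indicator (box a b) :: 'a \<Rightarrow> real) \<in> borel_measurable lebesgue"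
        by (intro borel_measurable_indicator) auto
      then show "(\<lambda>x. W x * indicator (box a b) x) \<in> borel_measurable lebesgue"
        using borel_measurable_times[OF \<open>W \<in> borel_measurable lebesgue\<close>] by blast
    qed (use W in auto)
    moreover have "(\<integral>x. W x * box_bump a b n x \<partial>lebesgue) = 0" for n
      using zero[OF box_bump_test_function[OF ab]]
      by (simp add: integral_restrict_space W_def mult.assoc)
    ultimately show ?thesis
      by (simp add: LIMSEQ_const_iff set_lebesgue_integral_def mult.commute)
  qed
  have W_AE: "AE x in lborel. x \<in> box a b \<longrightarrow> W x = 0" if ab: "cbox a b \<subseteq> \<Omega>" for a b
  proof -
    \<comment> \<open>\<open>W\<close> is only Lebesgue measurable, whereas the box criterion lives
      on \<open>lborel\<close>; a Borel representative bridges the two.\<close>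
    obtain f where [measurable]: "f \<in> borel_measurable lborel" and f: "AE x in lborel. W x = f x"
      using completion_ex_borel_measurable_real[of W lborel] by auto
    have f': "AE x in lebesgue. W x = f x" using f by (rule AE_completion)
    have f_lebesgue: "f \<in> borel_measurable lebesgue"
      using \<open>f \<in> borel_measurable lborel\<close> by (rule measurable_completion)
    have fint: "integrable lborel f"
    proof -
      have "integrable lebesgue f"
        using W f' integrable_cong_AE[OF \<open>W \<in> borel_measurable lebesgue\<close> f_lebesgue] by blast
      then show ?thesis by (simp add: integrable_completion)
    qed
    \<comment> \<open>Cutting off to \<open>box a b\<close> lets arbitrary boxes be tested: each
      meets it in a box whose closed box stays in \<open>\<Omega>\<close>.\<close>
    have "AE x in lborel. indicator (box a b) x * f x = 0"
    proof (rule AE_zero_if_box_integrals_zero)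
      show "integrable lborel (\<lambda>x. indicator (box a b) x * f x)"
        using integrable_mult_indicator[OF _ fint, of "box a b"] by simp
      fix c d :: 'a
      obtain p q where pq: "box c d \<inter> box a b = box p q"
        using box_Int_box by blast
      show "(LINT x:box c d|lborel. indicator (box a b) x * f x) = 0"
      \<comment> \<open>An empty open box may have a nonempty degenerate closed box outside
        \<open>cbox a b\<close>, so the closure argument requires nonemptiness.\<close>
      proof (cases "box p q = {}")
        case True
        then have "indicator (box c d) x * (indicator (box a b) x * f x) = 0" for x
          using pq by (auto split: split_indicator)
        then show ?thesis by (simp only: set_lebesgue_integral_def real_scaleR_def integral_zero)
      next
        case False
        have "cbox p q \<subseteq> cbox a b"
        proof -
          have "box p q \<subseteq> box a b" "box a b \<noteq> {}"
            using False pq by auto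
          then show ?thesis
            using False closure_mono[of "box p q" "box a b"] by (simp add: closure_box)
        qed
        then have "(LINT x:box p q|lebesgue. W x) = 0"
          using ab by (intro W_zero) auto
        also have "(LINT x:box p q|lebesgue. W x) = (LINT x:box p q|lebesgue. f x)"
          unfolding set_lebesgue_integral_def
        proof (rule integral_cong_AE)
          have ind: "(indicator (box p q) :: 'a \<Rightarrow> real) \<in> borel_measurable lebesgue"
            by (intro borel_measurable_indicator) auto
          show "(\<lambda>x. indicator (box p q) x *\<^sub>R W x) \<in> borel_measurable lebesgue"
            using ind \<open>W \<in> borel_measurable lebesgue\<close> by (rule borel_measurable_scaleR)
          show "(\<lambda>x. indicator (box p q) x *\<^sub>R f x) \<in> borel_measurable lebesgue"
            using ind f_lebesgue by (rule borel_measurable_scaleR)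
        qed (use f' in auto)
        also have "\<dots> = (LINT x:box p q|lborel. f x)"
          unfolding set_lebesgue_integral_def by (rule integral_completion) measurable
        also have "\<dots> = (LINT x:box c d|lborel. indicator (box a b) x * f x)"
          unfolding set_lebesgue_integral_def pq[symmetric]
          by (simp add: indicator_inter_arith mult.assoc)
        finally show ?thesis by simp
      qed
    qed
    with f show ?thesis by (auto simp: indicator_def)
  qed
  have W_AE': "AE x in lebesgue. x \<in> cbox a b \<longrightarrow> W x = 0" if ab: "cbox a b \<subseteq> \<Omega>" for a b
  proof -
    \<comment> \<open>The faces of a box are negligible; this matters because the cover below uses
      closed boxes.\<close>
    have "AE x in lebesgue. x \<notin> cbox a b - box a b"
      by (intro AE_not_in) (simp add: negligible_iff_null_sets[symmetric] negligible_frontier_interval)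
    with AE_completion[OF W_AE[OF ab]] show ?thesis
      by eventually_elim auto
  qed
  obtain \<D> where \<D>: "countable \<D>" "\<D> \<subseteq> Pow \<Omega>" "\<And>X. X \<in> \<D> \<Longrightarrow> \<exists>a b. X = cbox a b" "\<Union>\<D> = \<Omega>"
    using open_countable_Union_open_cbox[OF \<open>open \<Omega>\<close>] by metis
  have "AE x in lebesgue. \<forall>X\<in>\<D>. x \<in> X \<longrightarrow> W x = 0"
    using \<D> W_AE' by (subst AE_ball_countable) (auto, metis PowD subsetD)
  then have "AE x in lebesgue. x \<in> \<Omega> \<longrightarrow> w x = 0"
    by eventually_elim (use \<D>(4) in \<open>metis UnionE W_def indicator_simps(1) scaleR_one\<close>)
  then show ?thesis
    by (simp add: AE_restrict_space_iff)
qed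

section \<open>The zero function in Sobolev spaces\<close>

lemma zero_in_L2_on: "(\<lambda>x. 0) \<in> L2_on \<Omega>"
  by (simp add: L2_on_def)

lemma has_weak_deriv_zero: "has_weak_deriv \<Omega> bs (\<lambda>x. 0) (\<lambda>x. 0)"
  by (simp add: has_weak_deriv_def)

text \<open>
  \<^const>\<open>weak_deriv\<close> is chosen by \<open>SOME\<close>, so that even for the zero function its
  vanishing rests on the uniqueness of weak derivatives.
\<close>
lemma weak_deriv_zero:
  fixes \<Omega> :: "'a::euclidean_space set"
  assumes "open \<Omega>" "bounded \<Omega>"
  shows "weak_deriv \<Omega> bs (\<lambda>x. 0) \<in> L2_on \<Omega>"
    and "AE x in lebesgue_on \<Omega>. weak_deriv \<Omega> bs (\<lambda>x. 0) x = 0"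
proof -
  let ?w = "weak_deriv \<Omega> bs (\<lambda>x. 0)"
  have w: "?w \<in> L2_on \<Omega> \<and> has_weak_deriv \<Omega> bs (\<lambda>x. 0) ?w"
    unfolding weak_deriv_def
    by (rule someI[of _ "\<lambda>x. 0"]) (simp add: zero_in_L2_on has_weak_deriv_zero)
  then show "?w \<in> L2_on \<Omega>" by simp
  from w have "(\<integral>x. ?w x * \<phi> x \<partial>lebesgue_on \<Omega>) = 0" if "\<phi> \<in> test_functions \<Omega>" for \<phi>
    using that by (auto simp: has_weak_deriv_def)
  then show "AE x in lebesgue_on \<Omega>. ?w x = 0"
    using assms w by (intro fundamental_lemma_variations L2_on_imp_integrable) auto
qed

lemma gagliardo_zero:
  fixes \<Omega> :: "'a::euclidean_space set"
  assumes "open \<Omega>" "bounded \<Omega>" "w \<in> borel_measurable (lebesgue_on \<Omega>)" "AE x in lebesgue_on \<Omega>. w x = 0"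
  shows "gagliardo \<Omega> \<theta> w = 0"
proof -
  note [measurable] = \<open>w \<in> borel_measurable (lebesgue_on \<Omega>)\<close>
  interpret finite_measure "lebesgue_on \<Omega>"
    using assms by (intro finite_measure_lebesgue_on) (simp add: bounded_set_imp_lmeasurable)
  interpret pair_sigma_finite "lebesgue_on \<Omega>" "lebesgue_on \<Omega>" ..
  \<comment> \<open>Vanishing almost everywhere in each variable passes to the product
    measure.\<close>
  have "AE p in lebesgue_on \<Omega> \<Otimes>\<^sub>M lebesgue_on \<Omega>. w (fst p) = 0 \<and> w (snd p) = 0"
  proof (rule AE_pair_measure)
    show "{p \<in> space (lebesgue_on \<Omega> \<Otimes>\<^sub>M lebesgue_on \<Omega>). w (fst p) = 0 \<and> w (snd p) = 0}
        \<in> sets (lebesgue_on \<Omega> \<Otimes>\<^sub>M lebesgue_on \<Omega>)"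
      by measurable
    from assms(4) show "AE x in lebesgue_on \<Omega>. AE y in lebesgue_on \<Omega>.
        w (fst (x, y)) = 0 \<and> w (snd (x, y)) = 0"
      by (auto elim: AE_mp)
  qed
  \<comment> \<open>The numerator is 0 here, so the quotient is 0 on the diagonal too, by the
    convention \<open>0 / 0 = 0\<close>.\<close>
  then have "AE p in lebesgue_on \<Omega> \<Otimes>\<^sub>M lebesgue_on \<Omega>.
      (case p of (x, y) \<Rightarrow> ennreal ((w x - w y)\<^sup>2 / norm (x - y) powr (real DIM('a) + 2 * \<theta>))) = 0"
    by eventually_elim auto
  then have "gagliardo \<Omega> \<theta> w = (\<integral>\<^sup>+p. 0 \<partial>(lebesgue_on \<Omega> \<Otimes>\<^sub>M lebesgue_on \<Omega>))"
    unfolding gagliardo_def by (rule nn_integral_cong_AE)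
  then show ?thesis by simp
qed

lemma sobolev_zero:
  fixes \<Omega> :: "'a::euclidean_space set"
  assumes "open \<Omega>" "bounded \<Omega>"
  shows "(\<lambda>x. 0) \<in> sobolev \<Omega> s" "sobolev_norm \<Omega> s (\<lambda>x. 0) = 0"
proof -
  note D = weak_deriv_zero[OF assms]
  have gag: "gagliardo \<Omega> \<theta> (weak_deriv \<Omega> bs (\<lambda>x. 0)) = 0" for \<theta> bs
    using D[of bs] by (intro gagliardo_zero assms) (auto simp: L2_on_def)
  have "(\<integral>x. (weak_deriv \<Omega> bs (\<lambda>x. 0) x)\<^sup>2 \<partial>lebesgue_on \<Omega>) = 0" for bs
    by (rule integral_eq_zero_AE) (use D(2)[of bs] in auto)
  with gag show "sobolev_norm \<Omega> s (\<lambda>x. 0) = 0"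
    by (simp add: sobolev_norm_def)
  show "(\<lambda>x. 0) \<in> sobolev \<Omega> s"
    using zero_in_L2_on has_weak_deriv_zero gag by (auto simp: sobolev_def)
qed

lemma zero_in_sobolev0:
  fixes \<Omega> :: "'a::euclidean_space set"
  assumes "open \<Omega>" "bounded \<Omega>"
  shows "(\<lambda>x. 0) \<in> sobolev0 \<Omega> s"
proof -
  \<comment> \<open>Zero is itself a test function, hence its own approximation at every
    tolerance.\<close>
  have "(\<lambda>x. 0) \<in> test_functions \<Omega>"
    by (simp add: test_functions_def smooth_flat_algebra flat_algebra.const)
  with sobolev_zero[OF assms, of s] show ?thesis
    by (auto simp: sobolev0_def fun_diff_def intro!: bexI[of _ "\<lambda>x. 0"])
qed

section \<open>Nonnegativity of the dual norm\<close>

lemma sobolev_norm_nonneg: "0 \<le> sobolev_norm \<Omega> t v"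
  by (auto simp: sobolev_norm_def intro!: real_sqrt_ge_zero add_nonneg_nonneg sum_nonneg)

text \<open>
  The real supremum of an empty set is unspecified; the zero function shows that the unit ball
  of \<open>H\<^sup>s\<^sub>0\<close> is not empty.
\<close>
lemma sobolev_dual_norm_diff_nonneg:
  fixes \<Omega> :: "'a::euclidean_space set"
  assumes "open \<Omega>" "bounded \<Omega>" and F: "F \<in> sobolev_dual \<Omega> s" and G: "G \<in> sobolev_dual \<Omega> s"
  shows "0 \<le> sobolev_dual_norm \<Omega> s (F - G)"
proof -
  obtain A where A: "\<forall>\<phi>\<in>sobolev0 \<Omega> s. \<bar>F \<phi>\<bar> \<le> A * sobolev_norm \<Omega> s \<phi>"
    using F unfolding sobolev_dual_def by blast
  obtain B where B: "\<forall>\<phi>\<in>sobolev0 \<Omega> s. \<bar>G \<phi>\<bar> \<le> B * sobolev_norm \<Omega> s \<phi>"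
    using G unfolding sobolev_dual_def by blast
  let ?U = "{\<phi> \<in> sobolev0 \<Omega> s. sobolev_norm \<Omega> s \<phi> \<le> 1}"
  \<comment> \<open>A real supremum bounds its members only if the set is bounded above; both
    functionals supply a bound. Absolute values allow for negative \<open>A\<close> and
    \<open>B\<close>.\<close>
  have "\<bar>(F - G) \<phi>\<bar> \<le> \<bar>A\<bar> + \<bar>B\<bar>" if "\<phi> \<in> ?U" for \<phi>
  proof -
    have "c * sobolev_norm \<Omega> s \<phi> \<le> \<bar>c\<bar>" for c
    proof -
      have "c * sobolev_norm \<Omega> s \<phi> \<le> \<bar>c\<bar> * sobolev_norm \<Omega> s \<phi>"
        by (intro mult_right_mono sobolev_norm_nonneg) simp
      also have "\<dots> \<le> \<bar>c\<bar>"
        using that by (intro mult_left_le) auto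
      finally show ?thesis .
    qed
    then have "\<bar>F \<phi>\<bar> \<le> \<bar>A\<bar>" "\<bar>G \<phi>\<bar> \<le> \<bar>B\<bar>"
      using A B that order_trans by blast+
    then show ?thesis
      by (simp add: fun_diff_def)
  qed
  then have "bdd_above ((\<lambda>\<phi>. \<bar>(F - G) \<phi>\<bar>) ` ?U)"
    by (auto intro!: bdd_aboveI2)
  moreover have "(\<lambda>x. 0) \<in> ?U"
    using zero_in_sobolev0[OF assms(1,2), of s] sobolev_zero(2)[OF assms(1,2), of s] by simp
  ultimately have "\<bar>(F - G) (\<lambda>x. 0)\<bar> \<le> sobolev_dual_norm \<Omega> s (F - G)"
    unfolding sobolev_dual_norm_def by (intro cSUP_upper)
  then show ?thesis by linarith
qed

section \<open>Traces of functions continuous up to the boundary\<close>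

text \<open>The points of \<open>\<Omega>\<close> where the functions differ form an open null set,
  hence none exist; continuity carries equality to the closure.\<close>

lemma continuous_AE_eq_imp_eq:
  fixes f h :: "'a::euclidean_space \<Rightarrow> real"
  assumes "open \<Omega>" and f: "continuous_on (closure \<Omega>) f" and h: "continuous_on (closure \<Omega>) h"
    and ae: "AE x in lebesgue_on \<Omega>. f x = h x" and x: "x \<in> closure \<Omega>"
  shows "f x = h x"
proof -
  have d: "continuous_on (closure \<Omega>) (\<lambda>x. f x - h x)"
    using f h by (intro continuous_intros)
  let ?N = "\<Omega> \<inter> (\<lambda>x. f x - h x) -` (- {0})"
  have "open ?N"
    using continuous_on_subset[OF d closure_subset] \<open>open \<Omega>\<close>
    by (intro continuous_open_preimage) auto
  moreover have "AE x in lebesgue. x \<notin> ?N"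
    using ae \<open>open \<Omega>\<close> by (auto simp: AE_restrict_space_iff)
  then have "negligible ?N"
    using \<open>open ?N\<close> by (subst negligible_iff_null_sets, subst AE_iff_null_sets) auto
  ultimately have "?N = {}"
    using open_not_negligible by blast
  then have "f x - h x = 0"
    by (intro continuous_constant_on_closure[OF d _ x]) auto
  then show ?thesis by simp
qed

text \<open>Links the pointwise boundary condition of the minimization to the trace condition of
  \<open>sobolev_bc\<close>, by uniqueness of the continuous representative.\<close>

lemma continuous_has_trace_iff:
  fixes \<Omega> :: "'a::euclidean_space set"
  assumes "open \<Omega>" "continuous_on (closure \<Omega>) v"
  shows "has_trace \<Omega> v g \<longleftrightarrow> (\<forall>x\<in>frontier \<Omega>. v x = g x)"
proof
  assume "has_trace \<Omega> v g"
  then obtain w where w: "continuous_on (closure \<Omega>) w" "AE x in lebesgue_on \<Omega>. v x = w x"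
      "\<forall>x\<in>frontier \<Omega>. w x = g x"
    unfolding has_trace_def by blast
  then show "\<forall>x\<in>frontier \<Omega>. v x = g x"
    using continuous_AE_eq_imp_eq[OF assms w(1,2)] by (simp add: frontier_def)
next
  assume "\<forall>x\<in>frontier \<Omega>. v x = g x"
  with assms(2) show "has_trace \<Omega> v g"
    unfolding has_trace_def by (intro exI[of _ v]) auto
qed

section \<open>Convergence of the minimizers\<close>

theorem theorem2p3:
  fixes \<Omega> :: "'a::euclidean_space set" and s t :: real
    and g :: "'a \<Rightarrow> real"
    and P :: "('a \<Rightarrow> real) \<Rightarrow> (('a \<Rightarrow> real) \<Rightarrow> real)"
    and \<xi> :: "('a \<Rightarrow> real) \<Rightarrow> real"
    and ustar :: "'a \<Rightarrow> real"
    and K :: "'a \<Rightarrow> 'a \<Rightarrow> real"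
    and HK :: "('a \<Rightarrow> real) set"
    and ip :: "('a \<Rightarrow> real) \<Rightarrow> ('a \<Rightarrow> real) \<Rightarrow> real"
    and \<gamma> :: "nat \<Rightarrow> real"
    and u :: "nat \<Rightarrow> 'a \<Rightarrow> real"
  assumes domain: "open \<Omega>" "bounded \<Omega>" "lipschitz_boundary \<Omega>"
    and exponents: "s > 0" "t > 1/2" "t > real DIM('a) / 2"
    and boundary_data: "continuous_on (frontier \<Omega>) g" "g \<in> boundary_sobolev \<Omega> (t - 1/2)"
    and rkhs: "is_rkhs (closure \<Omega>) K HK ip"
    and P_maps: "P \<in> sobolev_bc \<Omega> t g \<rightarrow> sobolev_dual \<Omega> s"
    and xi: "\<xi> \<in> sobolev_dual \<Omega> s"
    and solution: "ustar \<in> sobolev_bc \<Omega> t g" "P ustar = \<xi>"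
    and unique: "\<And>v. v \<in> sobolev_bc \<Omega> t g \<Longrightarrow> P v = \<xi> \<Longrightarrow> (AE x in lebesgue_on \<Omega>. v x = ustar x)"
    and P_continuous:
      "\<And>v \<epsilon>. v \<in> sobolev_bc \<Omega> t g \<Longrightarrow> \<epsilon> > 0 \<Longrightarrow>
         \<exists>\<eta>>0. \<forall>w\<in>sobolev_bc \<Omega> t g.
           sobolev_norm \<Omega> t (w - v) < \<eta> \<longrightarrow> sobolev_dual_norm \<Omega> s (P w - P v) < \<epsilon>"
    and local_stability:
      "\<exists>\<delta>>0. \<exists>C>0. \<forall>v\<in>sobolev_bc \<Omega> t g.
         sobolev_dual_norm \<Omega> s (P v - \<xi>) < \<delta> \<longrightarrow>
         sobolev_norm \<Omega> t (v - ustar) \<le> C * sobolev_dual_norm \<Omega> s (P v - \<xi>)"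
    and embed_C:
      "compactly_embedded HK (ip_norm ip) {f. continuous_on (closure \<Omega>) f} (sup_norm (closure \<Omega>))"
    and embed_H:
      "compactly_embedded HK (ip_norm ip) (sobolev \<Omega> t) (sobolev_norm \<Omega> t)"
    and dense:
      "\<And>v \<epsilon>. v \<in> sobolev_bc \<Omega> t g \<Longrightarrow> \<epsilon> > 0 \<Longrightarrow>
         \<exists>w \<in> HK \<inter> sobolev_bc \<Omega> t g. sobolev_norm \<Omega> t (w - v) < \<epsilon>"
    and gamma: "\<And>n. \<gamma> n > 0" "decseq \<gamma>" "\<gamma> \<longlonglongrightarrow> 0"
    and minimizer:
      "\<And>n. is_arg_min
         (\<lambda>v. (sobolev_dual_norm \<Omega> s (P v - \<xi>))\<^sup>2 + \<gamma> n * (ip_norm ip v)\<^sup>2)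
         (\<lambda>v. v \<in> HK \<and> (\<forall>x\<in>frontier \<Omega>. v x = g x)) (u n)"
  shows "(\<lambda>n. sobolev_norm \<Omega> t (u n - ustar)) \<longlonglongrightarrow> 0 \<and>
    (\<lambda>n. (sobolev_dual_norm \<Omega> s (P (u n) - \<xi>))\<^sup>2 + \<gamma> n * (ip_norm ip (u n))\<^sup>2) \<longlonglongrightarrow> 0"
proof -
  define J where "J n v = (sobolev_dual_norm \<Omega> s (P v - \<xi>))\<^sup>2 + \<gamma> n * (ip_norm ip v)\<^sup>2" for n v
  \<comment> \<open>The embeddings put \<open>HK\<close> inside both the continuous functions and
    \<open>H^t\<close>, so the admissible set of the minimization is
    \<open>HK \<inter> sobolev_bc \<Omega> t g\<close>.\<close>
  have HK_bc: "v \<in> sobolev_bc \<Omega> t g \<longleftrightarrow> (\<forall>x\<in>frontier \<Omega>. v x = g x)" if "v \<in> HK" for v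
    using that embed_C embed_H continuous_has_trace_iff[OF domain(1), of v g]
    by (auto simp: compactly_embedded_def sobolev_bc_def)
  have u: "u n \<in> sobolev_bc \<Omega> t g" for n
    using minimizer[of n] HK_bc by (auto simp: is_arg_min_linorder)
  have u_min: "J n (u n) \<le> J n v" if "v \<in> HK" "v \<in> sobolev_bc \<Omega> t g" for n v
    using minimizer[of n] that HK_bc by (auto simp: is_arg_min_linorder J_def)
  have dual_nonneg: "0 \<le> sobolev_dual_norm \<Omega> s (P v - \<xi>)" if "v \<in> sobolev_bc \<Omega> t g" for v
    using sobolev_dual_norm_diff_nonneg[OF domain(1,2) _ xi] P_maps that by blast
  have residual_le: "(sobolev_dual_norm \<Omega> s (P (u n) - \<xi>))\<^sup>2 \<le> J n (u n)" for n
    using gamma(1)[of n] by (simp add: J_def)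
  have J_lim: "(\<lambda>n. J n (u n)) \<longlonglongrightarrow> 0"
  proof (rule LIMSEQ_I)
    fix r :: real assume "r > 0"
    \<comment> \<open>The tolerance \<open>sqrt (r / 2)\<close> gives the squared residual half of
      \<open>r\<close>; the other half is for the regularization.\<close>
    obtain \<eta> where "\<eta> > 0" and \<eta>: "\<And>w. w \<in> sobolev_bc \<Omega> t g \<Longrightarrow>
        sobolev_norm \<Omega> t (w - ustar) < \<eta> \<Longrightarrow> sobolev_dual_norm \<Omega> s (P w - \<xi>) < sqrt (r / 2)"
      using P_continuous[OF solution(1), of "sqrt (r / 2)"] \<open>r > 0\<close> solution(2) by auto
    obtain w where w: "w \<in> HK" "w \<in> sobolev_bc \<Omega> t g" "sobolev_norm \<Omega> t (w - ustar) < \<eta>"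
      using dense[OF solution(1) \<open>\<eta> > 0\<close>] by blast
    have "(sobolev_dual_norm \<Omega> s (P w - \<xi>))\<^sup>2 < (sqrt (r / 2))\<^sup>2"
      using \<eta> w dual_nonneg by (intro power_strict_mono) auto
    then have "(sobolev_dual_norm \<Omega> s (P w - \<xi>))\<^sup>2 < r / 2"
      using \<open>r > 0\<close> by simp
    \<comment> \<open>\<open>w\<close> depends on \<open>r\<close> but not on \<open>n\<close>, so
      its RKHS norm is a constant factor.\<close>
    moreover have "(\<lambda>n. \<gamma> n * (ip_norm ip w)\<^sup>2) \<longlonglongrightarrow> 0"
      using gamma(3) by (rule tendsto_mult_left_zero)
    then have "\<forall>\<^sub>F n in sequentially. \<gamma> n * (ip_norm ip w)\<^sup>2 < r / 2"
      using \<open>r > 0\<close> by (intro order_tendstoD) auto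
    ultimately have "\<forall>\<^sub>F n in sequentially. J n w < r"
      by (auto simp: J_def elim!: eventually_mono)
    then have "\<forall>\<^sub>F n in sequentially. norm (J n (u n) - 0) < r"
    proof eventually_elim
      case (elim n)
      have "0 \<le> J n (u n)"
        using residual_le zero_le_power2 by (rule order_trans[rotated])
      with elim u_min[OF w(1,2), of n] show ?case by simp
    qed
    then show "\<exists>N. \<forall>n\<ge>N. norm (J n (u n) - 0) < r"
      by (simp add: eventually_sequentially)
  qed
  have "(\<lambda>n. (sobolev_dual_norm \<Omega> s (P (u n) - \<xi>))\<^sup>2) \<longlonglongrightarrow> 0"
    using residual_le
    by (intro tendsto_sandwich[OF always_eventually always_eventually tendsto_const J_lim]) simp_all
  \<comment> \<open>The root of the square is the residual itself only because the residual is
    nonnegative.\<close>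
  then have residual_lim: "(\<lambda>n. sobolev_dual_norm \<Omega> s (P (u n) - \<xi>)) \<longlonglongrightarrow> 0"
    using tendsto_real_sqrt[of _ 0] dual_nonneg[OF u] by simp
  obtain \<delta> C where "\<delta> > 0" and stable: "\<And>v. v \<in> sobolev_bc \<Omega> t g \<Longrightarrow>
      sobolev_dual_norm \<Omega> s (P v - \<xi>) < \<delta> \<Longrightarrow>
      sobolev_norm \<Omega> t (v - ustar) \<le> C * sobolev_dual_norm \<Omega> s (P v - \<xi>)"
    using local_stability by blast
  \<comment> \<open>Stability is local, so it applies only once the residual has dropped below
    \<open>\<delta>\<close>.\<close>
  have "\<forall>\<^sub>F n in sequentially. sobolev_dual_norm \<Omega> s (P (u n) - \<xi>) < \<delta>"
    using residual_lim \<open>\<delta> > 0\<close> by (rule order_tendstoD)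
  then have upper: "\<forall>\<^sub>F n in sequentially.
      sobolev_norm \<Omega> t (u n - ustar) \<le> C * sobolev_dual_norm \<Omega> s (P (u n) - \<xi>)"
    using stable[OF u] by (rule eventually_mono)
  have "(\<lambda>n. C * sobolev_dual_norm \<Omega> s (P (u n) - \<xi>)) \<longlonglongrightarrow> 0"
    using residual_lim by (rule tendsto_mult_right_zero)
  then have "(\<lambda>n. sobolev_norm \<Omega> t (u n - ustar)) \<longlonglongrightarrow> 0"
    by (rule tendsto_sandwich[OF always_eventually[OF allI[OF sobolev_norm_nonneg]] upper tendsto_const])
  with J_lim show ?thesis
    unfolding J_def by (rule conjI[rotated])
qed

end
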